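(* Let $\mathcal G^0$ be an undirected graph with $N$ vertices and Laplacian $L^0=L(\mathcal G^0)$, let $p\in[0,1]$, let $\hat G$ be the decomposable jump linear system with nominal communication graph $\mathcal G^0$ and Bernoulli packet loss with transmission probability $p$, and let $\bar G$ be its mean system (both as defined in the context). For any $\gamma>0$, the following implications hold: (i) if $\hat G$ is mean-square stable, then $\bar G$ is stable; (ii) if $\|\hat G\|_{H_2}<\gamma$, then $\|\bar G\|_{H_2}<\gamma$.
   Context: Graphs: a graph $\mathcal G=(\mathcal V,\mathcal E)$ has vertex set $\mathcal V=\{v_1,\dots,v_N\}$ and edge set $\mathcal E\subset\mathcal V\times\mathcal V$ without self-loops; $e_{ij}=(v_j,v_i)$ is the edge from $v_j$ to $v_i$; $\mathcal G$ is undirected if $e_{ij}\in\mathcal E\Leftrightarrow e_{ji}\in\mathcal E$. The in-neighbourhood is $\mathcal N_i^-=\{v_j: e_{ij}\in\mathcal E\}$, with $d_i^-=|\mathcal N_i^-|$. The Laplacian $L(\mathcal G)=[l_{ij}]$ has $l_{ij}=-1$ if $i\ne j$ and $v_j\in\mathcal N_i^-$, $l_{ij}=0$ if $i\neq j$ and $v_j\notin\mathcal N_i^-$, and $l_{ii}=d_i^-$. Packet loss model ($\mathcal G^0=(\mathcal V,\mathcal E^0)$): to each edge $e_{ij}\in\mathcal E^0$ is attached a stationary process $\alpha_{ij}(k)\in\{0,1\}$, $k\ge0$ ($1$: packet transmitted, $0$: packet lost), independent in time, with $\Pr(\alpha_{ij}(k)=1)=p$ and $\Pr(\alpha_{ij}(k)=0)=1-p$.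 The variables $\alpha_{ij}(k)$ and $\alpha_{rs}(k')$ are independent whenever $k\ne k'$ or [$(r,s)\neq(i,j)$ and $(r,s)\ne(j,i)$] (so losses on opposing links $e_{ij}$, $e_{ji}$ may be correlated, and need not be equal). The mode $\sigma(k)\in\mathcal K=\{1,\dots,2^{|\mathcal E^0|}\}$ encodes bijectively the values $(\alpha_{ij}(k))_{e_{ij}\in\mathcal E^0}$; $\mathcal G_i=(\mathcal V,\mathcal E_i)$, where $\mathcal E_i\subseteq\mathcal E^0$ is the set of edges active ($\alpha=1$) in mode $i$, and $L_i=L(\mathcal G_i)$. Thus $\sigma(k)$ are independent over time with $\Pr(\sigma(k)=i)=t_i$, the probability of the corresponding loss pattern; when an initial distribution $\sigma_0$ (or value) is prescribed, it governs $\sigma(0)$, and $\Pr(\sigma(k)=i)=t_i$ independently for $k\ge1$. Decomposable jump linear system $\hat G$ ($\otimes$ is the Kronecker product; $A^d,A^c\in\mathbb R^{n_x\times n_x}$, $B^d,B^c\in\mathbb R^{n_x\times n_w}$, $C^d,C^c\in\mathbb R^{n_z\times n_x}$, $D^d,D^c\in\mathbb R^{n_z\times n_w}$): $$x(k+1)=(I_N\otimes A^d+L_{\sigma(k)}\otimes A^c)x(k)+(I_N\otimes B^d+L_{\sigma(k)}\otimes B^c)w(k),$$ $$z(k)=(I_N\otimes C^d+L_{\sigma(k)}\otimes C^c)x(k)+(I_N\otimes D^d+L_{\sigma(k)}\otimes D^c)w(k),$$ with $x(k)\in\mathbb R^{Nn_x}$, $w(k)\in\mathbb R^{Nn_w}$,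 $z(k)\in\mathbb R^{Nn_z}$, $x(0)=x_0$. Mean system $\bar G$ (a deterministic discrete-time LTI system): $$\bar x(k+1)=(I_N\otimes A^d+pL^0\otimes A^c)\bar x(k)+(I_N\otimes B^d+pL^0\otimes B^c)\bar w(k),$$ $$\bar z(k)=(I_N\otimes C^d+pL^0\otimes C^c)\bar x(k)+(I_N\otimes D^d+pL^0\otimes D^c)\bar w(k).$$ Stability of $\bar G$ means asymptotic stability, i.e. all eigenvalues of $I_N\otimes A^d+pL^0\otimes A^c$ have modulus less than $1$. Mean-square stability of $\hat G$: with $w\equiv0$, $\lim_{k\to\infty}\mathbb E[\|x(k)\|]=0$ and $\lim_{k\to\infty}\mathbb E[\|x(k)x^T(k)\|]=0$ for all initial conditions $x_0$ and all initial distributions $\sigma_0$. $H_2$-norms: for mean-square stable $\hat G$, $\|\hat G\|_{H_2}^2=\sum_{i\in\mathcal K}\sum_{s=1}^{Nn_w}t_i\|z^{s,i}\|^2$, where $z^{s,i}$ is the output for $x_0=0$, $\sigma(0)=i$, and a discrete unit impulse in the $s$-th input ($w(0)=$ the $s$-th standard basis vector, $w(k)=0$ for $k\ge1$), and $\|z\|^2=\sum_{k=0}^\infty\mathbb E[z^T(k)z(k)]$. The norm is defined only for stable systems, so "$\|\hat G\|_{H_2}<\gamma$" presupposes that $\hat G$ is mean-square stable. For stable $\bar G$, $\|\bar G\|_{H_2}$ is the usual LTI $H_2$-norm, $\|\bar G\|_{H_2}^2=\sum_{s=1}^{Nn_w}\sum_{k=0}^\infty\|\bar z^s(k)\|^2$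 with $\bar z^s$ the response from zero initial state to a discrete unit impulse in the $s$-th input. *)

theory Defs
  imports "HOL-Probability.Probability"
begin

section \<open>Graphs\<close>

text \<open>
  A graph on the vertices \<open>'n\<close> (so \<open>N = CARD('n)\<close>) is given by its edge set, where the pair
  \<open>(j, i)\<close> is the edge \<open>e\<^sub>i\<^sub>j\<close> from \<open>v\<^sub>j\<close> to \<open>v\<^sub>i\<close>. Absence of self-loops is \<open>irrefl E\<close>, and the
  graph is undirected iff \<open>sym E\<close>.
\<close>

definition in_nbhd :: "('n \<times> 'n) set \<Rightarrow> 'n \<Rightarrow> 'n set" where
  "in_nbhd E i = {j. (j, i) \<in> E}"

definition laplacian :: "('n::finite \<times> 'n) set \<Rightarrow> real^'n^'n" where
  "laplacian E = (\<chi> i j. if i = j then real (card (in_nbhd E i))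
                         else if j \<in> in_nbhd E i then - 1 else 0)"


section \<open>Linear systems\<close>

definition kronecker :: "real^'b^'a \<Rightarrow> real^'d^'c \<Rightarrow> real^('b \<times> 'd)^('a \<times> 'c)" where
  "kronecker A B = (\<chi> i j. A $ fst i $ fst j * B $ snd i $ snd j)"

record ('x::finite, 'w::finite, 'z::finite) lin_sys =
  sysA :: "real^'x^'x"
  sysB :: "real^'w^'x"
  sysC :: "real^'x^'z"
  sysD :: "real^'w^'z"

text \<open>Decoupled part \<open>Sd\<close> and coupled part \<open>Sc\<close>, interconnected through the matrix \<open>L\<close>.\<close>

definition decomposable ::
  "('x::finite, 'w::finite, 'z::finite) lin_sys \<Rightarrow> ('x, 'w, 'z) lin_sys \<Rightarrow> real^'n::finite^'n
    \<Rightarrow> ('n \<times> 'x, 'n \<times> 'w, 'n \<times> 'z) lin_sys" where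
  "decomposable Sd Sc L =
    \<lparr> sysA = kronecker (mat 1) (sysA Sd) + kronecker L (sysA Sc),
      sysB = kronecker (mat 1) (sysB Sd) + kronecker L (sysB Sc),
      sysC = kronecker (mat 1) (sysC Sd) + kronecker L (sysC Sc),
      sysD = kronecker (mat 1) (sysD Sd) + kronecker L (sysD Sc) \<rparr>"

text \<open>State and output of a time-varying system \<open>S\<close> with initial state \<open>x0\<close> and input \<open>w\<close>.\<close>

primrec state ::
  "(nat \<Rightarrow> ('x::finite, 'w::finite, 'z::finite) lin_sys) \<Rightarrow> real^'x \<Rightarrow> (nat \<Rightarrow> real^'w) \<Rightarrow> nat \<Rightarrow> real^'x" where
  "state S x0 w 0 = x0"
| "state S x0 w (Suc k) = sysA (S k) *v state S x0 w k + sysB (S k) *v w k"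

definition sys_output ::
  "(nat \<Rightarrow> ('x::finite, 'w::finite, 'z::finite) lin_sys) \<Rightarrow> real^'x \<Rightarrow> (nat \<Rightarrow> real^'w) \<Rightarrow> nat \<Rightarrow> real^'z" where
  "sys_output S x0 w k = sysC (S k) *v state S x0 w k + sysD (S k) *v w k"

definition impulse :: "'w \<Rightarrow> nat \<Rightarrow> real^'w" where
  "impulse s k = (if k = 0 then axis s 1 else 0)"

definition is_eigenvalue :: "complex \<Rightarrow> complex^'n^'n \<Rightarrow> bool" where
  "is_eigenvalue l A \<longleftrightarrow> (\<exists>v. v \<noteq> 0 \<and> A *v v = l *s v)"

text \<open>Eigenvalues of a real matrix are taken over the complex numbers.\<close>

definition lti_stable :: "('x::finite, 'w::finite, 'z::finite) lin_sys \<Rightarrow> bool" where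
  "lti_stable G \<longleftrightarrow>
    (\<forall>l. is_eigenvalue l (\<chi> i j. complex_of_real (sysA G $ i $ j)) \<longrightarrow> cmod l < 1)"

text \<open>
  The series in the \<open>H\<^sub>2\<close>-norms, here and below, are only meaningful for stable systems, where
  they converge.
\<close>

definition lti_H2_norm :: "('x::finite, 'w::finite, 'z::finite) lin_sys \<Rightarrow> real" where
  "lti_H2_norm G = sqrt (\<Sum>s\<in>UNIV. \<Sum>k. (norm (sys_output (\<lambda>_. G) 0 (impulse s) k))\<^sup>2)"

definition mean_system ::
  "('n::finite \<times> 'n) set \<Rightarrow> real \<Rightarrow> ('x::finite, 'w::finite, 'z::finite) lin_sys \<Rightarrow> ('x, 'w, 'z) lin_sys
    \<Rightarrow> ('n \<times> 'x, 'n \<times> 'w, 'n \<times> 'z) lin_sys" where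
  "mean_system E p Sd Sc = decomposable Sd Sc (p *\<^sub>R laplacian E)"


section \<open>Packet loss\<close>

text \<open>
  \<open>\<alpha> i j k \<omega>\<close> says that the packet sent over \<open>e\<^sub>i\<^sub>j\<close> at time \<open>k\<close> is transmitted. The modes are
  identified with the loss patterns they encode, that is, with the sets of active edges
  \<open>m \<subseteq> E\<close>; \<open>active_edges E \<alpha> k\<close> is the pattern generated at time \<open>k\<close>.
\<close>

definition active_edges ::
  "('n \<times> 'n) set \<Rightarrow> ('n \<Rightarrow> 'n \<Rightarrow> nat \<Rightarrow> 'a \<Rightarrow> bool) \<Rightarrow> nat \<Rightarrow> 'a \<Rightarrow> ('n \<times> 'n) set" where
  "active_edges E \<alpha> k \<omega> = {(j, i). (j, i) \<in> E \<and> \<alpha> i j k \<omega>}"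

text \<open>
  Independence of \<open>\<alpha> i j k\<close> and \<open>\<alpha> r s k'\<close> is required pairwise, and the whole patterns are
  (mutually) independent and identically distributed over time. The joint law of the opposing
  links \<open>e\<^sub>i\<^sub>j\<close> and \<open>e\<^sub>j\<^sub>i\<close> at one time is constrained only in its marginals.
  Mutual independence of all pairs of opposing links over space and time, together with
  stationarity, implies these conditions.
\<close>

definition bernoulli_packet_loss ::
  "'a measure \<Rightarrow> ('n \<times> 'n) set \<Rightarrow> real \<Rightarrow> ('n \<Rightarrow> 'n \<Rightarrow> nat \<Rightarrow> 'a \<Rightarrow> bool) \<Rightarrow> bool" where
  "bernoulli_packet_loss M E p \<alpha> \<longleftrightarrow>
    prob_space M \<and>
    (\<forall>i j k. (j, i) \<in> E \<longrightarrow> \<alpha> i j k \<in> measurable M (count_space UNIV)) \<and>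
    (\<forall>i j k. (j, i) \<in> E \<longrightarrow>
       measure M {\<omega> \<in> space M. \<alpha> i j k \<omega>} = p \<and>
       measure M {\<omega> \<in> space M. \<not> \<alpha> i j k \<omega>} = 1 - p) \<and>
    (\<forall>i j r s k k'. (j, i) \<in> E \<and> (s, r) \<in> E \<and>
       (k \<noteq> k' \<or> (r, s) \<noteq> (i, j) \<and> (r, s) \<noteq> (j, i)) \<longrightarrow>
       prob_space.indep_var M (count_space UNIV) (\<alpha> i j k) (count_space UNIV) (\<alpha> r s k')) \<and>
    prob_space.indep_vars M (\<lambda>_. count_space UNIV) (active_edges E \<alpha>) UNIV \<and>
    (\<forall>k m. measure M {\<omega> \<in> space M. active_edges E \<alpha> k \<omega> = m}
         = measure M {\<omega> \<in> space M. active_edges E \<alpha> 0 \<omega> = m})"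

definition mode_prob ::
  "'a measure \<Rightarrow> ('n \<times> 'n) set \<Rightarrow> ('n \<Rightarrow> 'n \<Rightarrow> nat \<Rightarrow> 'a \<Rightarrow> bool) \<Rightarrow> ('n \<times> 'n) set \<Rightarrow> real" where
  "mode_prob M E \<alpha> m = measure M {\<omega> \<in> space M. active_edges E \<alpha> 0 \<omega> = m}"

text \<open>
  The mode process \<open>\<sigma>\<close> with prescribed initial distribution \<open>\<mu>\<close> lives on
  \<open>measure_pmf \<mu> \<Otimes>\<^sub>M M\<close>: \<open>\<sigma>(0)\<close> is the first component, and \<open>\<sigma>(k)\<close> for \<open>k \<ge> 1\<close> is the loss
  pattern at time \<open>k\<close>, independent of \<open>\<sigma>(0)\<close>.
\<close>

definition mode_process ::
  "('n \<times> 'n) set \<Rightarrow> ('n \<Rightarrow> 'n \<Rightarrow> nat \<Rightarrow> 'a \<Rightarrow> bool)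
    \<Rightarrow> ('n \<times> 'n) set \<times> 'a \<Rightarrow> nat \<Rightarrow> ('n \<times> 'n) set" where
  "mode_process E \<alpha> \<xi> k = (if k = 0 then fst \<xi> else active_edges E \<alpha> k (snd \<xi>))"

definition jump_system ::
  "('n::finite \<times> 'n) set \<Rightarrow> ('n \<Rightarrow> 'n \<Rightarrow> nat \<Rightarrow> 'a \<Rightarrow> bool)
    \<Rightarrow> ('x::finite, 'w::finite, 'z::finite) lin_sys \<Rightarrow> ('x, 'w, 'z) lin_sys
    \<Rightarrow> ('n \<times> 'n) set \<times> 'a \<Rightarrow> nat \<Rightarrow> ('n \<times> 'x, 'n \<times> 'w, 'n \<times> 'z) lin_sys" where
  "jump_system E \<alpha> Sd Sc \<xi> k = decomposable Sd Sc (laplacian (mode_process E \<alpha> \<xi> k))"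

definition mean_square_stable ::
  "'a measure \<Rightarrow> ('n::finite \<times> 'n) set \<Rightarrow> ('n \<Rightarrow> 'n \<Rightarrow> nat \<Rightarrow> 'a \<Rightarrow> bool)
    \<Rightarrow> ('x::finite, 'w::finite, 'z::finite) lin_sys \<Rightarrow> ('x, 'w, 'z) lin_sys \<Rightarrow> bool" where
  "mean_square_stable M E \<alpha> Sd Sc \<longleftrightarrow>
    (\<forall>(x0 :: real^('n \<times> 'x)) (\<mu> :: ('n \<times> 'n) set pmf). set_pmf \<mu> \<subseteq> Pow E \<longrightarrow>
      (let x = (\<lambda>k \<xi>. state (jump_system E \<alpha> Sd Sc \<xi>) x0 (\<lambda>_. 0) k) in
        (\<lambda>k. LINT \<xi>|(measure_pmf \<mu> \<Otimes>\<^sub>M M). norm (x k \<xi>)) \<longlonglongrightarrow> 0 \<and>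
        (\<lambda>k. LINT \<xi>|(measure_pmf \<mu> \<Otimes>\<^sub>M M).
               norm ((columnvector (x k \<xi>) :: real^1^('n \<times> 'x)) ** rowvector (x k \<xi>)))
          \<longlonglongrightarrow> 0))"

definition jump_H2_norm ::
  "'a measure \<Rightarrow> ('n::finite \<times> 'n) set \<Rightarrow> ('n \<Rightarrow> 'n \<Rightarrow> nat \<Rightarrow> 'a \<Rightarrow> bool)
    \<Rightarrow> ('x::finite, 'w::finite, 'z::finite) lin_sys \<Rightarrow> ('x, 'w, 'z) lin_sys \<Rightarrow> real" where
  "jump_H2_norm M E \<alpha> Sd Sc =
    sqrt (\<Sum>m\<in>Pow E. \<Sum>s\<in>UNIV. mode_prob M E \<alpha> m *
      (\<Sum>k. LINT \<xi>|(measure_pmf (return_pmf m) \<Otimes>\<^sub>M M).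
             (let z = sys_output (jump_system E \<alpha> Sd Sc \<xi>) 0 (impulse s) k in z \<bullet> z)))"

end

theory Submission
  imports Defs
begin

text \<open>
  Averaging the trajectories of the jump system over the loss patterns, with the initial mode
  distributed like the later ones, yields the trajectories of the mean system: the state at time
  \<open>k\<close> is independent of the mode at time \<open>k\<close>, and the Laplacian of the active edges has mean
  \<open>p L\<^sup>0\<close>. By Jensen's inequality the squares of the mean states and outputs are dominated by the
  second moments of the jump system. This gives (i) at once, and (ii) by summation over time. The
  series of second moments has to converge for this; indeed, the expected energy after \<open>k\<close>
  steps is a quadratic form in the initial state that tends to 0, so some number of steps halves
  it uniformly, and it decays geometrically.
\<close>

section \<open>Functions of finitely many modes: measurability and integrability\<close>

definition determined_below :: "nat \<Rightarrow> ((nat \<Rightarrow> 'm) \<Rightarrow> 'b) \<Rightarrow> bool" where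
  "determined_below k g \<longleftrightarrow> (\<forall>h h'. (\<forall>j<k. h j = h' j) \<longrightarrow> g h = g h')"

lemma determined_below_restrict:
  "determined_below k g \<Longrightarrow> g (restrict h {..<k}) = g h"
  unfolding determined_below_def by (metis lessThan_iff restrict_apply')

lemma measurable_history:
  fixes \<sigma> :: "'a \<Rightarrow> nat \<Rightarrow> 'm::finite"
  assumes "\<And>j. (\<lambda>\<xi>. \<sigma> \<xi> j) \<in> measurable M (count_space UNIV)"
  shows "(\<lambda>\<xi>. restrict (\<sigma> \<xi>) {..<k}) \<in> measurable M (Pi\<^sub>M {..<k} (\<lambda>_. count_space UNIV))"
  by (rule measurable_restrict) (rule assms)

text \<open>A finite product of counting spaces over a finite type is again a counting space, so
  every function of a finite mode history is measurable, into any codomain.\<close>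

lemma measurable_history_function:
  fixes g :: "(nat \<Rightarrow> 'm::finite) \<Rightarrow> 'b"
  shows "g \<in> measurable (Pi\<^sub>M {..<k::nat} (\<lambda>_. count_space UNIV)) (count_space UNIV)"
  by (subst count_space_PiM_finite) auto

lemma measurable_determined_below:
  fixes \<sigma> :: "'a \<Rightarrow> nat \<Rightarrow> 'm::finite"
  assumes "\<And>j. (\<lambda>\<xi>. \<sigma> \<xi> j) \<in> measurable M (count_space UNIV)"
    and "determined_below k g"
  shows "(\<lambda>\<xi>. g (\<sigma> \<xi>)) \<in> measurable M (count_space UNIV)"
  using measurable_compose[OF measurable_history[OF assms(1)] measurable_history_function[of g k]]
  by (simp add: determined_below_restrict[OF assms(2)])

lemma finite_range_determined_below:
  fixes g :: "(nat \<Rightarrow> 'm::finite) \<Rightarrow> 'b"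
  assumes "determined_below k g"
  shows "finite (range g)"
proof (rule finite_subset)
  show "range g \<subseteq> g ` (PiE {..<k} (\<lambda>_. UNIV))"
    using determined_below_restrict[OF assms] by (metis (no_types, lifting) UNIV_I image_iff
        image_subsetI restrict_PiE_iff)
  show "finite (g ` (PiE {..<k} (\<lambda>_. UNIV :: 'm set)))"
    by (intro finite_imageI finite_PiE) auto
qed

text \<open>Only finitely many histories of length \<open>k\<close> exist, so \<open>g\<close> takes
  finitely many values and is bounded.\<close>

lemma integrable_determined_below:
  fixes \<sigma> :: "'a \<Rightarrow> nat \<Rightarrow> 'm::finite" and g :: "(nat \<Rightarrow> 'm) \<Rightarrow> real"
  assumes "finite_measure M" and "\<And>j. (\<lambda>\<xi>. \<sigma> \<xi> j) \<in> measurable M (count_space UNIV)"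
    and "determined_below k g"
  shows "integrable M (\<lambda>\<xi>. g (\<sigma> \<xi>))"
proof -
  interpret finite_measure M by fact
  have fin: "finite (range (\<lambda>h. \<bar>g h\<bar>))"
    using finite_imageI[OF finite_range_determined_below[OF assms(3)], of abs]
    by (simp add: image_image)
  show ?thesis
  proof (rule integrable_const_bound)
    show "AE \<xi> in M. norm (g (\<sigma> \<xi>)) \<le> Max (range (\<lambda>h. \<bar>g h\<bar>))"
      using fin by (intro AE_I2) (auto intro!: Max_ge)
    show "(\<lambda>\<xi>. g (\<sigma> \<xi>)) \<in> borel_measurable M"
      using measurable_determined_below[OF assms(2,3)]
      by (rule measurable_compose) simp
  qed
qed

section \<open>Independent, identically distributed modes\<close>

locale iid_modes = prob_space M
  for M :: "'a measure" and a :: "nat \<Rightarrow> 'a \<Rightarrow> 'm::finite" and q :: "'m \<Rightarrow> real" +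
  assumes indep_modes: "indep_vars (\<lambda>_. count_space UNIV) a UNIV"
    and law_modes: "\<And>k m. measure M {\<omega> \<in> space M. a k \<omega> = m} = q m"
begin

lemma measurable_modes [measurable]: "a k \<in> measurable M (count_space UNIV)"
  using indep_modes unfolding indep_vars_def by auto

text \<open>Realises the mode process with a deterministic initial mode on \<open>M\<close> itself.
  A random initial mode is obtained later as a weighted sum over \<open>m0\<close>.\<close>

definition path :: "'m \<Rightarrow> 'a \<Rightarrow> nat \<Rightarrow> 'm" where
  "path m0 \<omega> j = (if j = 0 then m0 else a j \<omega>)"

lemma path_0 [simp]: "path m0 \<omega> 0 = m0"
  by (simp add: path_def)

lemma measurable_path: "(\<lambda>\<omega>. path m0 \<omega> j) \<in> measurable M (count_space UNIV)"
  by (simp add: path_def)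

lemma integrable_path:
  fixes g :: "(nat \<Rightarrow> 'm) \<Rightarrow> real"
  assumes "determined_below k g"
  shows "integrable M (\<lambda>\<omega>. g (path m0 \<omega>))"
  using finite_measure_axioms measurable_path assms by (rule integrable_determined_below)

lemma integral_mode_indicator: "(\<integral>\<omega>. indicator {m} (a k \<omega>) \<partial>M) = q m"
proof -
  have "(\<integral>\<omega>. indicator {m} (a k \<omega>) \<partial>M) = (\<integral>\<omega>. indicator {\<omega> \<in> space M. a k \<omega> = m} \<omega> \<partial>M)"
    by (intro Bochner_Integration.integral_cong) (auto simp: indicator_def)
  also have "\<dots> = q m"
    using law_modes[of k m] by (simp add: Int_def conj_commute)
  finally show ?thesis .
qed

lemma integral_mode:
  fixes g :: "'m \<Rightarrow> real"
  shows "(\<integral>\<omega>. g (a k \<omega>) \<partial>M) = (\<Sum>m\<in>UNIV. q m * g m)"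
proof -
  have "(\<integral>\<omega>. g (a k \<omega>) \<partial>M) = (\<integral>\<omega>. (\<Sum>m\<in>UNIV. indicator {m} (a k \<omega>) * g m) \<partial>M)"
    by (simp add: indicator_def if_distrib [of "\<lambda>x. x * _"] cong: if_cong)
  also have "\<dots> = (\<Sum>m\<in>UNIV. (\<integral>\<omega>. indicator {m} (a k \<omega>) * g m \<partial>M))"
    by (intro Bochner_Integration.integral_sum integrable_mult_left
          integrable_const_bound[where B = 1]) (auto simp: indicator_def)
  finally show ?thesis
    by (simp add: integral_mode_indicator)
qed

lemma q_nonneg: "q m \<ge> 0"
  using law_modes[of 0 m] measure_nonneg by metis

lemma sum_q: "(\<Sum>m\<in>UNIV. q m) = 1"
  using integral_mode[of "\<lambda>_. 1"] by (simp add: prob_space)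

text \<open>The path before time \<open>k\<close> is a function of the modes with index in
  \<open>{..<k}\<close>, and the mode at time \<open>k\<close> has its index in the disjoint set
  \<open>{k}\<close>.\<close>

lemma indep_history:
  fixes X :: "(nat \<Rightarrow> 'm) \<Rightarrow> real" and Y :: "'m \<Rightarrow> real"
  assumes "determined_below k X" and "k > 0"
  shows "indep_var borel (\<lambda>\<omega>. X (path m0 \<omega>)) borel (\<lambda>\<omega>. Y (a k \<omega>))"
proof -
  \<comment> \<open>\<open>?X\<close> overwrites time 0 by \<open>m0\<close>, which turns
    \<open>X\<close> of the path into a function of the restricted family of modes.\<close>
  let ?X = "\<lambda>h. X (\<lambda>j. if j = 0 then m0 else h j)"
  have "indep_var (Pi\<^sub>M {..<k} (\<lambda>_. count_space UNIV)) (\<lambda>\<omega>. restrict (\<lambda>j. a j \<omega>) {..<k})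
     (Pi\<^sub>M {k} (\<lambda>_. count_space UNIV)) (\<lambda>\<omega>. restrict (\<lambda>j. a j \<omega>) {k})"
    by (rule indep_var_restrict[OF indep_modes]) auto
  moreover have "?X \<in> borel_measurable (Pi\<^sub>M {..<k} (\<lambda>_. count_space UNIV))"
    by (rule measurable_compose[OF measurable_history_function[of "\<lambda>h. h"]]) simp
  moreover have "(\<lambda>h. Y (h k)) \<in> borel_measurable (Pi\<^sub>M {k} (\<lambda>_. count_space UNIV))"
    by (rule measurable_compose[OF measurable_component_singleton]) simp_all
  ultimately have "indep_var borel (?X \<circ> (\<lambda>\<omega>. restrict (\<lambda>j. a j \<omega>) {..<k}))
     borel ((\<lambda>h. Y (h k)) \<circ> (\<lambda>\<omega>. restrict (\<lambda>j. a j \<omega>) {k}))"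
    by (rule indep_var_compose)
  moreover have "?X (restrict (\<lambda>j. a j \<omega>) {..<k}) = X (path m0 \<omega>)" for \<omega>
    using assms(1) unfolding determined_below_def by (auto simp: path_def)
  ultimately show ?thesis
    by (simp add: comp_def)
qed

text \<open>The integrand is split by the value of the mode at time \<open>k\<close>; in each term
  the indicator of that value is independent of the past, so the expectation factors.\<close>

lemma integral_step:
  fixes g :: "(nat \<Rightarrow> 'm) \<Rightarrow> 'm \<Rightarrow> real"
  assumes "\<And>m. determined_below k (\<lambda>h. g h m)" and "k > 0"
  shows "(\<integral>\<omega>. g (path m0 \<omega>) (a k \<omega>) \<partial>M) = (\<Sum>m\<in>UNIV. q m * (\<integral>\<omega>. g (path m0 \<omega>) m \<partial>M))"
proof -
  have ind: "integrable M (\<lambda>\<omega>. indicator {m} (a k \<omega>) :: real)" for m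
    by (intro integrable_const_bound[where B = 1]) (auto simp: indicator_def)
  note int = integrable_path[OF assms(1)]
  have "(\<integral>\<omega>. g (path m0 \<omega>) (a k \<omega>) \<partial>M)
      = (\<integral>\<omega>. (\<Sum>m\<in>UNIV. g (path m0 \<omega>) m * indicator {m} (a k \<omega>)) \<partial>M)"
    by (simp add: indicator_def if_distrib [of "\<lambda>x. _ * x"] cong: if_cong)
  also have "\<dots> = (\<Sum>m\<in>UNIV. (\<integral>\<omega>. g (path m0 \<omega>) m * indicator {m} (a k \<omega>) \<partial>M))"
    by (intro Bochner_Integration.integral_sum indep_var_integrable int ind indep_history assms)
  also have "\<dots> = (\<Sum>m\<in>UNIV. (\<integral>\<omega>. g (path m0 \<omega>) m \<partial>M) * q m)"
    by (subst indep_var_lebesgue_integral[OF indep_history[OF assms] int ind])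
       (simp add: integral_mode_indicator)
  finally show ?thesis by (simp add: mult.commute)
qed

end

text \<open>Fubini, followed by evaluation at the only atom of the point mass.\<close>

lemma integral_pair_return_pmf:
  fixes f :: "'b \<times> 'a \<Rightarrow> real"
  assumes "prob_space M" and "integrable (measure_pmf (return_pmf m) \<Otimes>\<^sub>M M) f"
  shows "(\<integral>\<xi>. f \<xi> \<partial>(measure_pmf (return_pmf m) \<Otimes>\<^sub>M M)) = (\<integral>\<omega>. f (m, \<omega>) \<partial>M)"
proof -
  interpret M: prob_space M by fact
  interpret pair_sigma_finite "measure_pmf (return_pmf m)" M ..
  have "(\<integral>\<xi>. f \<xi> \<partial>(measure_pmf (return_pmf m) \<Otimes>\<^sub>M M))
     = (\<integral>x. (\<integral>\<omega>. f (x, \<omega>) \<partial>M) \<partial>measure_pmf (return_pmf m))"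
    using assms(2) by (rule integral_fst'[symmetric])
  also have "\<dots> = (\<integral>\<omega>. f (m, \<omega>) \<partial>M)"
    by (subst integral_measure_pmf_real[of "{m}"]) auto
  finally show ?thesis .
qed

section \<open>Trajectories of linear systems, a stability criterion and a summability
  criterion\<close>

lemma state_cong:
  "(\<And>j. j < k \<Longrightarrow> S j = S' j) \<Longrightarrow> state S x0 w k = state S' x0 w k"
  by (induction k) auto

lemma determined_below_state:
  "determined_below k (\<lambda>h. f (state (\<lambda>j. S (h j)) x0 w k))"
  unfolding determined_below_def
  by (intro allI impI arg_cong[where f = f] state_cong arg_cong[where f = S]) auto

text \<open>The state at time \<open>k\<close> involves only earlier modes, but the next state and
  the output also use the mode at time \<open>k\<close>; hence the bound
  \<open>Suc k\<close>.\<close>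

lemma determined_below_state_mode:
  "determined_below (Suc k) (\<lambda>h. f (state (\<lambda>j. S (h j)) x0 w k) (h k))"
  unfolding determined_below_def
  by (intro allI impI arg_cong2[where f = f] state_cong arg_cong[where f = S]) auto

text \<open>The trajectories from the real and imaginary parts of an eigenvector \<open>v\<close>
  combine to \<open>l ^ k * v\<close>. A nonzero coordinate of this tends to 0 only if
  \<open>l\<close> has modulus below 1.\<close>

lemma lti_stable_if_state_tendsto_0:
  fixes G :: "('x::finite, 'w::finite, 'z::finite) lin_sys"
  assumes "\<And>x0 i. (\<lambda>k. state (\<lambda>_. G) x0 (\<lambda>_. 0) k $ i) \<longlonglongrightarrow> 0"
  shows "lti_stable G"
  unfolding lti_stable_def is_eigenvalue_def
proof (intro allI impI, elim exE conjE)
  fix l :: complex and v :: "complex^'x"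
  assume v: "v \<noteq> 0" and eig: "(\<chi> i j. complex_of_real (sysA G $ i $ j)) *v v = l *s v"
  have eig': "(\<Sum>j\<in>UNIV. complex_of_real (sysA G $ i $ j) * v $ j) = l * v $ i" for i
    using arg_cong[OF eig, of "\<lambda>x. x $ i"] by (simp add: matrix_vector_mult_def)
  define X where "X k = state (\<lambda>_. G) (\<chi> i. Re (v $ i)) (\<lambda>_. 0) k" for k
  define Y where "Y k = state (\<lambda>_. G) (\<chi> i. Im (v $ i)) (\<lambda>_. 0) k" for k
  have pow: "Complex (X k $ i) (Y k $ i) = l ^ k * v $ i" for k i
  proof (induction k arbitrary: i)
    case 0
    show ?case by (simp add: X_def Y_def)
  next
    case (Suc k)
    have "Complex (X (Suc k) $ i) (Y (Suc k) $ i)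
        = (\<Sum>j\<in>UNIV. complex_of_real (sysA G $ i $ j) * Complex (X k $ j) (Y k $ j))"
      by (simp add: X_def Y_def matrix_vector_mult_def complex_eq_iff)
    also have "\<dots> = l ^ k * (\<Sum>j\<in>UNIV. complex_of_real (sysA G $ i $ j) * v $ j)"
      by (simp add: Suc.IH sum_distrib_left mult_ac)
    finally show ?case by (simp add: eig')
  qed
  obtain i where i: "v $ i \<noteq> 0"
    using v by (auto simp: vec_eq_iff)
  have "(\<lambda>k. Complex (X k $ i) (Y k $ i)) \<longlonglongrightarrow> Complex 0 0"
    unfolding X_def Y_def by (intro tendsto_Complex assms)
  then have "(\<lambda>k. cmod (l ^ k * v $ i)) \<longlonglongrightarrow> cmod (Complex 0 0)"
    unfolding pow by (rule tendsto_norm)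
  then have lim: "(\<lambda>k. cmod l ^ k * cmod (v $ i)) \<longlonglongrightarrow> 0"
    by (simp add: norm_mult norm_power complex_norm)
  show "cmod l < 1"
  proof (rule ccontr)
    assume "\<not> cmod l < 1"
    then have "cmod (v $ i) \<le> cmod l ^ k * cmod (v $ i)" for k
      by (simp add: one_le_power mult_le_cancel_right1)
    then have "cmod (v $ i) \<le> 0"
      using lim by (intro LIMSEQ_le_const) auto
    then show False using i by simp
  qed
qed

text \<open>A partial sum is at most the sum of the first \<open>K\<close> terms plus half of
  itself, hence at most twice the sum of those terms.\<close>

lemma summable_if_shift_halves:
  fixes u :: "nat \<Rightarrow> real"
  assumes "\<And>k. 0 \<le> u k" and "\<And>k. u (k + K) \<le> u k / 2"
  shows "summable u"
proof (rule summableI_nonneg_bounded[where x = "2 * (\<Sum>k<K. u k)"])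
  fix n
  have "(\<Sum>k<n. u k) \<le> (\<Sum>k<n + K. u k)"
    by (intro sum_mono2) (auto simp: assms(1))
  also have "\<dots> = (\<Sum>k<K. u k) + (\<Sum>k<n. u (k + K))"
    by (induction n) auto
  also have "(\<Sum>k<n. u (k + K)) \<le> (\<Sum>k<n. u k) / 2"
    unfolding sum_divide_distrib by (intro sum_mono assms(2))
  finally show "(\<Sum>k<n. u k) \<le> 2 * (\<Sum>k<K. u k)" by simp
qed (fact assms(1))

section \<open>Averaged trajectories of a jump linear system\<close>

locale jump_lin_sys = iid_modes M a q
  for M :: "'a measure" and a :: "nat \<Rightarrow> 'a \<Rightarrow> 'm::finite" and q +
  fixes S :: "'m \<Rightarrow> ('x::finite, 'w::finite, 'z::finite) lin_sys"
begin

abbreviation jstate :: "real^'x \<Rightarrow> (nat \<Rightarrow> real^'w) \<Rightarrow> 'm \<Rightarrow> nat \<Rightarrow> 'a \<Rightarrow> real^'x" where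
  "jstate x0 w m0 k \<omega> \<equiv> state (\<lambda>j. S (path m0 \<omega> j)) x0 w k"

lemma integrable_state: "integrable M (\<lambda>\<omega>. f (jstate x0 w m0 k \<omega>) :: real)"
  by (rule integrable_path[OF determined_below_state])

lemma integrable_state_mode: "integrable M (\<lambda>\<omega>. f (jstate x0 w m0 k \<omega>) (path m0 \<omega> k) :: real)"
  by (rule integrable_path[OF determined_below_state_mode])

lemma integral_state_step:
  assumes "k > 0"
  shows "(\<integral>\<omega>. f (jstate x0 w m0 k \<omega>) (path m0 \<omega> k) \<partial>M)
    = (\<Sum>m\<in>UNIV. q m * (\<integral>\<omega>. f (jstate x0 w m0 k \<omega>) m \<partial>M))"
  using integral_step[where g = "\<lambda>h m. f (state (\<lambda>j. S (h j)) x0 w k) m",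
      OF determined_below_state assms, of m0] assms
  by (simp add: path_def)

text \<open>Expectation with the initial mode drawn from the common law \<open>q\<close> of the later modes.\<close>

definition avg :: "real^'x \<Rightarrow> (nat \<Rightarrow> real^'w) \<Rightarrow> nat \<Rightarrow> (real^'x \<Rightarrow> 'm \<Rightarrow> real) \<Rightarrow> real" where
  "avg x0 w k f = (\<Sum>m0\<in>UNIV. q m0 * (\<integral>\<omega>. f (jstate x0 w m0 k \<omega>) (path m0 \<omega> k) \<partial>M))"

text \<open>Under \<open>avg\<close> the mode at every time has law \<open>q\<close> and is
  independent of the state at that time. At time 0 this holds because the initial mode is drawn from
  \<open>q\<close> and the state is deterministic.\<close>

lemma avg_step: "avg x0 w k f = (\<Sum>m\<in>UNIV. q m * avg x0 w k (\<lambda>x _. f x m))"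
proof (cases "k = 0")
  case True
  then show ?thesis
    by (simp add: avg_def prob_space flip: sum_distrib_right) (simp add: sum_q)
next
  case False
  then have "avg x0 w k f
      = (\<Sum>m0\<in>UNIV. \<Sum>m\<in>UNIV. q m * (q m0 * (\<integral>\<omega>. f (jstate x0 w m0 k \<omega>) m \<partial>M)))"
    by (simp add: avg_def integral_state_step sum_distrib_left mult.left_commute)
  also have "\<dots> = (\<Sum>m\<in>UNIV. q m * avg x0 w k (\<lambda>x _. f x m))"
    by (subst sum.swap) (simp add: avg_def sum_distrib_left)
  finally show ?thesis .
qed

lemma avg_Suc:
  "avg x0 w (Suc k) (\<lambda>x _. f x) = avg x0 w k (\<lambda>x m. f (sysA (S m) *v x + sysB (S m) *v w k))"
  by (simp add: avg_def)

lemma avg_const: "avg x0 w k (\<lambda>_ _. c) = c"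
  by (simp add: avg_def prob_space sum_q flip: sum_distrib_right)

lemma avg_add: "avg x0 w k (\<lambda>x m. f x m + g x m) = avg x0 w k f + avg x0 w k g"
  unfolding avg_def
  by (subst Bochner_Integration.integral_add[OF integrable_state_mode integrable_state_mode])
     (simp add: distrib_left sum.distrib)

lemma avg_cmult: "avg x0 w k (\<lambda>x m. c * f x m) = c * avg x0 w k f"
  by (simp add: avg_def sum_distrib_left mult_ac)

lemma avg_sum:
  "finite I \<Longrightarrow> avg x0 w k (\<lambda>x m. \<Sum>i\<in>I. f i x m) = (\<Sum>i\<in>I. avg x0 w k (f i))"
  by (induction I rule: finite_induct) (simp_all add: avg_add avg_const)

lemma avg_mono: "(\<And>x m. f x m \<le> g x m) \<Longrightarrow> avg x0 w k f \<le> avg x0 w k g"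
  unfolding avg_def
  by (intro sum_mono mult_left_mono integral_mono integrable_state_mode q_nonneg) auto

text \<open>Jensen's inequality for the square, in the form that the variance is
  nonnegative.\<close>

lemma avg_power2_le: "(avg x0 w k f)\<^sup>2 \<le> avg x0 w k (\<lambda>x m. (f x m)\<^sup>2)"
proof -
  define c where "c = avg x0 w k f"
  have "0 \<le> avg x0 w k (\<lambda>x m. (f x m - c)\<^sup>2)"
    using avg_mono[of "\<lambda>_ _. 0" "\<lambda>x m. (f x m - c)\<^sup>2"] by (simp add: avg_const)
  also have "\<dots> = avg x0 w k (\<lambda>x m. (f x m)\<^sup>2 + ((- 2 * c) * f x m + c\<^sup>2))"
    by (simp add: power2_diff algebra_simps)
  also have "\<dots> = avg x0 w k (\<lambda>x m. (f x m)\<^sup>2) - c\<^sup>2"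
    unfolding avg_add avg_cmult avg_const by (simp add: c_def power2_eq_square)
  finally show ?thesis by (simp add: c_def)
qed

text \<open>For the decomposable modes this turns out to be the mean system, since their
  coefficients are affine in the Laplacian.\<close>

definition avg_sys :: "('x, 'w, 'z) lin_sys" where
  "avg_sys = \<lparr> sysA = (\<Sum>m\<in>UNIV. q m *\<^sub>R sysA (S m)), sysB = (\<Sum>m\<in>UNIV. q m *\<^sub>R sysB (S m)),
     sysC = (\<Sum>m\<in>UNIV. q m *\<^sub>R sysC (S m)), sysD = (\<Sum>m\<in>UNIV. q m *\<^sub>R sysD (S m)) \<rparr>"

text \<open>By \<open>avg_step\<close> the mode-dependent coefficients are independent of the state,
  so the mean of each product is the product of the means. General \<open>P\<close> and
  \<open>Q\<close> cover both the state update and the output.\<close>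

lemma avg_affine:
  fixes P :: "'m \<Rightarrow> real^'x^'b" and Q :: "'m \<Rightarrow> real^'c^'b"
  assumes "\<And>j. avg x0 w k (\<lambda>x _. x $ j) = y $ j"
  shows "avg x0 w k (\<lambda>x m. (P m *v x + Q m *v u) $ i)
    = ((\<Sum>m\<in>UNIV. q m *\<^sub>R P m) *v y + (\<Sum>m\<in>UNIV. q m *\<^sub>R Q m) *v u) $ i"
proof -
  have "avg x0 w k (\<lambda>x m. (P m *v x + Q m *v u) $ i)
      = (\<Sum>m\<in>UNIV. q m * ((\<Sum>j\<in>UNIV. P m $ i $ j * y $ j) + (\<Sum>j\<in>UNIV. Q m $ i $ j * u $ j)))"
    by (subst avg_step)
       (simp add: matrix_vector_mult_def avg_add avg_sum avg_cmult avg_const assms)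
  also have "\<dots> = (\<Sum>j\<in>UNIV. (\<Sum>m\<in>UNIV. q m * P m $ i $ j) * y $ j)
      + (\<Sum>j\<in>UNIV. (\<Sum>m\<in>UNIV. q m * Q m $ i $ j) * u $ j)"
    by (simp add: distrib_left sum.distrib sum_distrib_left sum_distrib_right mult.assoc
        sum.swap[of _ _ "UNIV :: 'm set"])
  finally show ?thesis by (simp add: matrix_vector_mult_def)
qed

lemma avg_jstate: "avg x0 w k (\<lambda>x _. x $ i) = state (\<lambda>_. avg_sys) x0 w k $ i"
proof (induction k arbitrary: i)
  case 0
  show ?case by (simp add: avg_def prob_space sum_q flip: sum_distrib_right)
next
  case (Suc k)
  show ?case
    unfolding avg_Suc[where f = "\<lambda>x. x $ i"] by (subst avg_affine[OF Suc]) (simp add: avg_sys_def)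
qed

lemma avg_sys_output:
  "avg x0 w k (\<lambda>x m. (sysC (S m) *v x + sysD (S m) *v w k) $ i)
    = sys_output (\<lambda>_. avg_sys) x0 w k $ i"
  by (subst avg_affine[OF avg_jstate]) (simp add: avg_sys_def sys_output_def)

section \<open>Decay of the expected energy\<close>

text \<open>\<open>energy k x\<close> is the expected squared norm after \<open>k\<close> i.i.d. steps from \<open>x\<close> with zero input.\<close>

primrec energy :: "nat \<Rightarrow> real^'x \<Rightarrow> real" where
  "energy 0 x = x \<bullet> x"
| "energy (Suc k) x = (\<Sum>m\<in>UNIV. q m * energy k (sysA (S m) *v x))"

lemma energy_nonneg: "energy k x \<ge> 0"
  by (induction k arbitrary: x) (auto intro!: sum_nonneg mult_nonneg_nonneg q_nonneg)

text \<open>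
  Replaces the argument that \<open>energy k\<close> is a quadratic form bounded by the trace of its matrix; in
  this form it is preserved by the recursion.
\<close>

lemma energy_sum_le:
  "finite I \<Longrightarrow> energy k (\<Sum>i\<in>I. c i *\<^sub>R y i) \<le> (\<Sum>i\<in>I. (c i)\<^sup>2) * (\<Sum>i\<in>I. energy k (y i))"
proof (induction k arbitrary: y)
  case 0
  have "norm (\<Sum>i\<in>I. c i *\<^sub>R y i) \<le> (\<Sum>i\<in>I. \<bar>c i\<bar> * norm (y i))"
    by (rule order_trans[OF norm_sum]) simp
  then have "(norm (\<Sum>i\<in>I. c i *\<^sub>R y i))\<^sup>2 \<le> (\<Sum>i\<in>I. \<bar>c i\<bar> * norm (y i))\<^sup>2"
    by (intro power_mono) auto
  also have "\<dots> \<le> (\<Sum>i\<in>I. \<bar>c i\<bar>\<^sup>2) * (\<Sum>i\<in>I. (norm (y i))\<^sup>2)"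
    by (rule Cauchy_Schwarz_ineq_sum)
  finally show ?case by (simp add: power2_norm_eq_inner)
next
  case (Suc k)
  have "energy (Suc k) (\<Sum>i\<in>I. c i *\<^sub>R y i)
      = (\<Sum>m\<in>UNIV. q m * energy k (\<Sum>i\<in>I. c i *\<^sub>R (sysA (S m) *v y i)))"
    by (simp add: linear_sum[OF matrix_vector_mul_linear] matrix_vector_mult_scaleR)
  also have "\<dots> \<le> (\<Sum>m\<in>UNIV. q m * ((\<Sum>i\<in>I. (c i)\<^sup>2) * (\<Sum>i\<in>I. energy k (sysA (S m) *v y i))))"
    by (intro sum_mono mult_left_mono Suc q_nonneg)
  also have "\<dots> = (\<Sum>i\<in>I. (c i)\<^sup>2) * (\<Sum>m\<in>UNIV. \<Sum>i\<in>I. q m * energy k (sysA (S m) *v y i))"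
    by (simp add: sum_distrib_left mult.left_commute)
  also have "\<dots> = (\<Sum>i\<in>I. (c i)\<^sup>2) * (\<Sum>i\<in>I. energy (Suc k) (y i))"
    by (subst sum.swap) simp
  finally show ?case .
qed

text \<open>Expansion of \<open>x\<close> in the standard basis; the constant is the trace of the
  matrix of the quadratic form \<open>energy k\<close>.\<close>

lemma energy_le: "energy k x \<le> (\<Sum>i\<in>UNIV. energy k (axis i 1)) * (x \<bullet> x)"
proof -
  have "x = (\<Sum>i\<in>UNIV. x $ i *\<^sub>R axis i 1)"
    using basis_expansion[of x] by (simp add: scalar_mult_eq_scaleR)
  then have "energy k x \<le> (\<Sum>i\<in>UNIV. (x $ i)\<^sup>2) * (\<Sum>i\<in>UNIV. energy k (axis i 1))"
    using energy_sum_le[of UNIV k "\<lambda>i. x $ i" "\<lambda>i. axis i 1"] by simp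
  then show ?thesis
    by (simp add: inner_vec_def power2_eq_square mult.commute)
qed

text \<open>The recursion peels off the first \<open>j\<close> steps, and \<open>energy_le\<close>
  bounds the remaining \<open>k\<close>. Once the constant is below 1, this yields geometric
  decay.\<close>

lemma energy_add_le: "energy (j + k) x \<le> (\<Sum>i\<in>UNIV. energy k (axis i 1)) * energy j x"
proof (induction j arbitrary: x)
  case 0
  show ?case using energy_le by simp
next
  case (Suc j)
  show ?case
    by (auto simp: sum_distrib_left mult.left_commute
        intro!: order_trans[OF sum_mono[OF mult_left_mono[OF Suc q_nonneg]]])
qed

text \<open>Without input, the last step of the trajectory can be traded for one unfolding of
  \<open>energy\<close>, because its mode is independent of the state before it. The condition
  \<open>k > 0\<close> keeps the fixed mode \<open>m0\<close> out of the traded steps.\<close>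

lemma integral_energy_state:
  assumes "k > 0" and "\<And>j. j \<ge> k \<Longrightarrow> w j = 0"
  shows "(\<integral>\<omega>. energy i (jstate x0 w m0 (k + l) \<omega>) \<partial>M)
    = (\<integral>\<omega>. energy (i + l) (jstate x0 w m0 k \<omega>) \<partial>M)"
proof (induction l arbitrary: i)
  case 0
  show ?case by simp
next
  case (Suc l)
  have "(\<integral>\<omega>. energy i (jstate x0 w m0 (k + Suc l) \<omega>) \<partial>M)
      = (\<integral>\<omega>. energy i (sysA (S (path m0 \<omega> (k + l))) *v jstate x0 w m0 (k + l) \<omega>) \<partial>M)"
    using assms(2)[of "k + l"] by simp
  also have "\<dots> = (\<Sum>m\<in>UNIV. q m * (\<integral>\<omega>. energy i (sysA (S m) *v jstate x0 w m0 (k + l) \<omega>) \<partial>M))"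
    using assms(1) by (intro integral_state_step) simp
  also have "\<dots> = (\<integral>\<omega>. energy (Suc i) (jstate x0 w m0 (k + l) \<omega>) \<partial>M)"
    by (subst energy.simps, subst Bochner_Integration.integral_sum)
       (auto intro!: integrable_mult_right integrable_state)
  also have "\<dots> = (\<integral>\<omega>. energy (i + Suc l) (jstate x0 w m0 k \<omega>) \<partial>M)"
    by (simp only: Suc add_Suc_right add_Suc)
  finally show ?case .
qed

text \<open>The first step uses the fixed mode \<open>m0\<close>, so the state at time 1 is
  deterministic; only the \<open>l\<close> steps after it are averaged.\<close>

lemma integral_energy_state_1:
  assumes "\<And>j. j > 0 \<Longrightarrow> w j = 0"
  shows "(\<integral>\<omega>. energy 0 (jstate x0 w m0 (Suc l) \<omega>) \<partial>M)
    = energy l (sysA (S m0) *v x0 + sysB (S m0) *v w 0)"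
  using integral_energy_state[where k = 1 and w = w and i = 0 and l = l] assms by (simp add: prob_space)

text \<open>Conditioning on the first mode \<open>m\<close> writes \<open>energy (Suc k) x\<close>
  as a \<open>q\<close>-weighted sum of second moments of trajectories started in mode
  \<open>m\<close>. Modes of weight 0 contribute nothing, so stability is assumed for the others
  only.\<close>

lemma energy_tendsto_0:
  assumes stable: "\<And>m0 x0. q m0 \<noteq> 0 \<Longrightarrow>
      (\<lambda>k. \<integral>\<omega>. jstate x0 (\<lambda>_. 0) m0 k \<omega> \<bullet> jstate x0 (\<lambda>_. 0) m0 k \<omega> \<partial>M) \<longlonglongrightarrow> 0"
  shows "(\<lambda>k. energy k x) \<longlonglongrightarrow> 0"
proof -
  have "(\<lambda>k. q m * energy k (sysA (S m) *v x)) \<longlonglongrightarrow> 0" for m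
  proof (cases "q m = 0")
    case False
    have "(\<lambda>k. \<integral>\<omega>. energy 0 (jstate x (\<lambda>_. 0) m (Suc k) \<omega>) \<partial>M) \<longlonglongrightarrow> 0"
      using LIMSEQ_Suc[OF stable[OF False, of x]] by (simp del: state.simps)
    then show ?thesis
      by (intro tendsto_mult_right_zero) (simp add: integral_energy_state_1 del: energy.simps state.simps)
  qed simp
  then have "(\<lambda>k. energy (Suc k) x) \<longlonglongrightarrow> 0"
    by (simp add: tendsto_null_sum)
  then show ?thesis by (rule LIMSEQ_imp_Suc)
qed

lemma summable_energy:
  assumes "\<And>x. (\<lambda>k. energy k x) \<longlonglongrightarrow> 0"
  shows "summable (\<lambda>k. energy k x)"
proof -
  have "(\<lambda>k. \<Sum>i\<in>UNIV. energy k (axis i 1)) \<longlonglongrightarrow> 0"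
    by (intro tendsto_null_sum assms)
  then have "eventually (\<lambda>k. (\<Sum>i\<in>UNIV. energy k (axis i 1)) < 1 / 2) sequentially"
    by (rule order_tendstoD) simp
  \<comment> \<open>This \<open>K\<close> is uniform in the state, since
    \<open>energy_add_le\<close> reduces all states to the finitely many basis vectors.\<close>
  then obtain K where K: "(\<Sum>i\<in>UNIV. energy K (axis i 1)) < 1 / 2"
    by (auto simp: eventually_sequentially)
  have "energy (k + K) x \<le> energy k x / 2" for k
    using energy_add_le[of k K x] mult_right_mono[OF less_imp_le[OF K] energy_nonneg[of k x]]
    by simp
  then show ?thesis
    by (intro summable_if_shift_halves energy_nonneg)
qed

section \<open>Comparison of the averaged system with the jump system\<close>

lemma lti_stable_avg_sys:
  assumes "\<And>x. (\<lambda>k. avg x (\<lambda>_. 0) k (\<lambda>y _. y \<bullet> y)) \<longlonglongrightarrow> 0"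
  shows "lti_stable avg_sys"
proof (rule lti_stable_if_state_tendsto_0)
  fix x0 i
  have "(\<lambda>k. (state (\<lambda>_. avg_sys) x0 (\<lambda>_. 0) k $ i)\<^sup>2) \<longlonglongrightarrow> 0"
  proof (rule tendsto_sandwich[OF _ _ tendsto_const assms])
    show "\<forall>\<^sub>F k in sequentially. (state (\<lambda>_. avg_sys) x0 (\<lambda>_. 0) k $ i)\<^sup>2
        \<le> avg x0 (\<lambda>_. 0) k (\<lambda>y _. y \<bullet> y)"
    proof (intro always_eventually allI)
      fix k
      have "(x $ i)\<^sup>2 \<le> x \<bullet> x" for x :: "real^'x"
        unfolding inner_vec_def by (rule order_trans[OF _ member_le_sum[of i]])
          (auto simp: power2_eq_square)
      then show "(state (\<lambda>_. avg_sys) x0 (\<lambda>_. 0) k $ i)\<^sup>2 \<le> avg x0 (\<lambda>_. 0) k (\<lambda>y _. y \<bullet> y)"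
        unfolding avg_jstate[symmetric] by (intro order_trans[OF avg_power2_le] avg_mono)
    qed
  qed simp
  then show "(\<lambda>k. state (\<lambda>_. avg_sys) x0 (\<lambda>_. 0) k $ i) \<longlonglongrightarrow> 0"
    by simp
qed

lemma avg_energy_tendsto_0:
  assumes "\<And>m0. q m0 \<noteq> 0 \<Longrightarrow>
      (\<lambda>k. \<integral>\<omega>. jstate x (\<lambda>_. 0) m0 k \<omega> \<bullet> jstate x (\<lambda>_. 0) m0 k \<omega> \<partial>M) \<longlonglongrightarrow> 0"
  shows "(\<lambda>k. avg x (\<lambda>_. 0) k (\<lambda>y _. y \<bullet> y)) \<longlonglongrightarrow> 0"
  unfolding avg_def
proof (intro tendsto_null_sum)
  fix m0
  show "(\<lambda>k. q m0 * (\<integral>\<omega>. jstate x (\<lambda>_. 0) m0 k \<omega> \<bullet> jstate x (\<lambda>_. 0) m0 k \<omega> \<partial>M)) \<longlonglongrightarrow> 0"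
    using assms[of m0] by (cases "q m0 = 0") (auto intro: tendsto_mult_right_zero)
qed

abbreviation output_energy :: "'m \<Rightarrow> 'w \<Rightarrow> nat \<Rightarrow> real" where
  "output_energy m0 s k \<equiv>
    (\<integral>\<omega>. (let z = sys_output (\<lambda>j. S (path m0 \<omega> j)) 0 (impulse s) k in z \<bullet> z) \<partial>M)"

text \<open>After time 0 the impulse has vanished, so the output energy is at most a constant times
  the expected squared norm of the state, which is a summable \<open>energy\<close>
  sequence.\<close>

lemma summable_output_energy:
  assumes "\<And>x. (\<lambda>k. energy k x) \<longlonglongrightarrow> 0"
  shows "summable (output_energy m0 s)"
proof -
  \<comment> \<open>Summing over the finitely many modes gives one bound valid for all of
    them.\<close>
  define c where "c = (\<Sum>m\<in>UNIV. (onorm ((*v) (sysC (S m))))\<^sup>2)"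
  have C: "(sysC (S m) *v x) \<bullet> (sysC (S m) *v x) \<le> c * (x \<bullet> x)" for m x
  proof -
    have "norm (sysC (S m) *v x) \<le> onorm ((*v) (sysC (S m))) * norm x"
      by (intro onorm matrix_vector_mul_bounded_linear)
    then have "(norm (sysC (S m) *v x))\<^sup>2 \<le> (onorm ((*v) (sysC (S m))))\<^sup>2 * (norm x)\<^sup>2"
      by (metis norm_ge_zero power_mono power_mult_distrib)
    also have "\<dots> \<le> c * (norm x)\<^sup>2"
      unfolding c_def by (intro mult_right_mono member_le_sum) auto
    finally show ?thesis by (simp add: power2_norm_eq_inner)
  qed
  \<comment> \<open>Time 0, the only time with a feedthrough term, is split off. At time
    \<open>Suc k\<close> the state has evolved for \<open>k\<close> random steps from the state
    \<open>sysB (S m0) *v axis s 1\<close> reached at time 1.\<close>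
  have "summable (\<lambda>k. output_energy m0 s (Suc k))"
  proof (rule summable_comparison_test')
    show "summable (\<lambda>k. c * energy k (sysB (S m0) *v axis s 1))"
      by (intro summable_mult summable_energy assms)
    fix k :: nat
    have "output_energy m0 s (Suc k) \<le> (\<integral>\<omega>. c * energy 0 (jstate 0 (impulse s) m0 (Suc k) \<omega>) \<partial>M)"
      unfolding sys_output_def Let_def
      by (intro integral_mono integrable_state integrable_state_mode[where f =
          "\<lambda>x m. (sysC (S m) *v x + sysD (S m) *v impulse s (Suc k)) \<bullet>
                 (sysC (S m) *v x + sysD (S m) *v impulse s (Suc k))"])
         (use C in \<open>simp add: impulse_def del: state.simps\<close>)
    also have "\<dots> = c * energy k (sysB (S m0) *v axis s 1)"
      using integral_energy_state_1[where w = "impulse s" and l = k]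
      by (simp add: impulse_def del: energy.simps state.simps)
    finally show "norm (output_energy m0 s (Suc k)) \<le> c * energy k (sysB (S m0) *v axis s 1)"
      by (simp add: Let_def integral_nonneg_AE)
  qed
  then show ?thesis using summable_Suc_iff[of "output_energy m0 s"] by blast
qed

text \<open>Jensen's inequality in each output coordinate, summed over the coordinates.\<close>

lemma avg_output_le:
  "(norm (sys_output (\<lambda>_. avg_sys) 0 (impulse s) k))\<^sup>2 \<le> (\<Sum>m0\<in>UNIV. q m0 * output_energy m0 s k)"
proof -
  let ?z = "\<lambda>x m. sysC (S m) *v x + sysD (S m) *v impulse s k"
  have "(norm (sys_output (\<lambda>_. avg_sys) 0 (impulse s) k))\<^sup>2
     = (\<Sum>i\<in>UNIV. (avg 0 (impulse s) k (\<lambda>x m. ?z x m $ i))\<^sup>2)"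
    unfolding avg_sys_output power2_norm_eq_inner inner_vec_def by (simp add: power2_eq_square)
  also have "\<dots> \<le> (\<Sum>i\<in>UNIV. avg 0 (impulse s) k (\<lambda>x m. (?z x m $ i)\<^sup>2))"
    by (intro sum_mono avg_power2_le)
  also have "\<dots> = avg 0 (impulse s) k (\<lambda>x m. ?z x m \<bullet> ?z x m)"
    by (simp add: avg_sum[symmetric] inner_vec_def power2_eq_square)
  finally show ?thesis by (simp add: avg_def sys_output_def Let_def)
qed

text \<open>Sums \<open>avg_output_le\<close> over time. Summability is what permits comparing the
  series termwise and exchanging them with the finite sum over modes, since \<open>suminf\<close> of
  a divergent series is unspecified.\<close>

lemma H2_le:
  assumes "\<And>x. (\<lambda>k. energy k x) \<longlonglongrightarrow> 0"
  shows "(\<Sum>s\<in>UNIV. \<Sum>k. (norm (sys_output (\<lambda>_. avg_sys) 0 (impulse s) k))\<^sup>2)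
    \<le> (\<Sum>m0\<in>UNIV. \<Sum>s\<in>UNIV. q m0 * (\<Sum>k. output_energy m0 s k))"
proof -
  note sm = summable_mult[OF summable_output_energy[OF assms]]
  have sum: "summable (\<lambda>k. \<Sum>m0\<in>UNIV. q m0 * output_energy m0 s k)" for s
    by (intro summable_sum sm)
  have "(\<Sum>k. (norm (sys_output (\<lambda>_. avg_sys) 0 (impulse s) k))\<^sup>2)
      \<le> (\<Sum>m0\<in>UNIV. q m0 * (\<Sum>k. output_energy m0 s k))" for s
  proof -
    have "(\<Sum>k. (norm (sys_output (\<lambda>_. avg_sys) 0 (impulse s) k))\<^sup>2)
        \<le> (\<Sum>k. \<Sum>m0\<in>UNIV. q m0 * output_energy m0 s k)"
      by (intro suminf_le avg_output_le sum summable_comparison_test'[OF sum])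
         (use avg_output_le in auto)
    also have "\<dots> = (\<Sum>m0\<in>UNIV. q m0 * (\<Sum>k. output_energy m0 s k))"
      by (subst suminf_sum[OF sm]) (simp add: suminf_mult summable_output_energy[OF assms])
    finally show ?thesis .
  qed
  then show ?thesis
    by (subst sum.swap) (intro sum_mono)
qed

end

section \<open>Outer products, Kronecker products and Laplacian entries\<close>

lemma norm_columnvector_rowvector:
  fixes x :: "real^'x::finite"
  shows "norm ((columnvector x :: real^1^'x) ** rowvector x) = x \<bullet> x"
proof -
  \<comment> \<open>The matrix norm is the Euclidean norm of the row norms, that is, the Frobenius
    norm, and each row of the outer product is a multiple of \<open>x\<close>.\<close>
  have row: "((columnvector x :: real^1^'x) ** rowvector x) $ i = x $ i *\<^sub>R x" for i
    by (simp add: matrix_matrix_mult_def columnvector_def rowvector_def vec_eq_iff)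
  have "norm ((columnvector x :: real^1^'x) ** rowvector x)
      = sqrt (\<Sum>i\<in>UNIV. (x $ i)\<^sup>2 * (norm x)\<^sup>2)"
    unfolding norm_vec_def[of "columnvector x ** rowvector x"] L2_set_def row
    by (simp add: power_mult_distrib)
  also have "\<dots> = sqrt ((x \<bullet> x) * (norm x)\<^sup>2)"
    by (simp add: inner_vec_def power2_eq_square flip: sum_distrib_right)
  also have "\<dots> = x \<bullet> x"
    by (simp add: power2_norm_eq_inner)
  finally show ?thesis .
qed

lemma kronecker_sum_left:
  "(\<Sum>m\<in>I. q m *\<^sub>R (kronecker A B + kronecker (L m) C))
    = (\<Sum>m\<in>I. q m) *\<^sub>R kronecker A B + kronecker (\<Sum>m\<in>I. q m *\<^sub>R L m) C"
  by (simp add: kronecker_def vec_eq_iff distrib_left sum.distrib sum_distrib_right mult.assoc)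

text \<open>The Kronecker product is linear in its left factor, and the weights sum to 1, which
  leaves the decoupled part unchanged.\<close>

lemma (in iid_modes) avg_sys_decomposable:
  "jump_lin_sys.avg_sys q (\<lambda>m. decomposable Sd Sc (L m))
    = decomposable Sd Sc (\<Sum>m\<in>UNIV. q m *\<^sub>R L m)"
proof -
  interpret jump_lin_sys M a q "\<lambda>m. decomposable Sd Sc (L m)" ..
  show ?thesis
    unfolding avg_sys_def by (simp add: decomposable_def kronecker_sum_left sum_q)
qed

text \<open>Written this way, every entry is linear in the edge indicators, so its mean over the
  loss patterns reduces to probabilities of single edges.\<close>

lemma laplacian_nth:
  "laplacian m $ i $ j
    = (if i = j then \<Sum>l\<in>UNIV. of_bool ((l, i) \<in> m) else - of_bool ((j, i) \<in> m))"
  by (simp add: laplacian_def in_nbhd_def of_bool_def sum.If_cases)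

section \<open>The packet loss model and its expected Laplacian\<close>

locale packet_loss =
  fixes M :: "'a measure" and E :: "('n::finite \<times> 'n) set" and p :: real
    and \<alpha> :: "'n \<Rightarrow> 'n \<Rightarrow> nat \<Rightarrow> 'a \<Rightarrow> bool"
  assumes bernoulli: "bernoulli_packet_loss M E p \<alpha>"

sublocale packet_loss \<subseteq> iid_modes M "active_edges E \<alpha>" "mode_prob M E \<alpha>"
  using bernoulli unfolding bernoulli_packet_loss_def iid_modes_def iid_modes_axioms_def mode_prob_def
  by blast

context packet_loss
begin

lemma mode_prob_eq_0: "\<not> m \<subseteq> E \<Longrightarrow> mode_prob M E \<alpha> m = 0"
proof -
  assume "\<not> m \<subseteq> E"
  then have "{\<omega> \<in> space M. active_edges E \<alpha> 0 \<omega> = m} = {}"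
    by (auto simp: active_edges_def)
  then show ?thesis
    unfolding mode_prob_def by (simp only: measure_empty)
qed

text \<open>The sum is the probability that the edge is active at time 0, which is \<open>p\<close>
  for edges of \<open>E\<close> by the marginal law.\<close>

lemma sum_mode_prob_edge:
  "(\<Sum>m\<in>UNIV. mode_prob M E \<alpha> m * of_bool ((j, i) \<in> m)) = p * of_bool ((j, i) \<in> E)"
proof -
  have "(\<Sum>m\<in>UNIV. mode_prob M E \<alpha> m * of_bool ((j, i) \<in> m))
      = (\<integral>\<omega>. of_bool ((j, i) \<in> active_edges E \<alpha> 0 \<omega>) \<partial>M)"
    by (rule integral_mode[symmetric])
  also have "\<dots> = (\<integral>\<omega>. indicator {\<omega> \<in> space M. (j, i) \<in> E \<and> \<alpha> i j 0 \<omega>} \<omega> \<partial>M)"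
    by (intro Bochner_Integration.integral_cong) (auto simp: active_edges_def indicator_def)
  also have "\<dots> = measure M {\<omega> \<in> space M. (j, i) \<in> E \<and> \<alpha> i j 0 \<omega>}"
    by (simp add: Int_def conj_ac)
  also have "\<dots> = p * of_bool ((j, i) \<in> E)"
    using bernoulli unfolding bernoulli_packet_loss_def by simp
  finally show ?thesis .
qed

lemma sum_mode_prob_laplacian:
  "(\<Sum>m\<in>UNIV. mode_prob M E \<alpha> m *\<^sub>R laplacian m) = p *\<^sub>R laplacian E"
proof -
  have "(\<Sum>m\<in>UNIV. mode_prob M E \<alpha> m * laplacian m $ i $ j) = p * laplacian E $ i $ j" for i j
  proof (cases "i = j")
    case True
    then have "(\<Sum>m\<in>UNIV. mode_prob M E \<alpha> m * laplacian m $ i $ j)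
        = (\<Sum>l\<in>UNIV. \<Sum>m\<in>UNIV. mode_prob M E \<alpha> m * of_bool ((l, i) \<in> m))"
      unfolding laplacian_nth by (simp only: simp_thms if_True sum_distrib_left) (rule sum.swap)
    then show ?thesis
      using True unfolding sum_mode_prob_edge laplacian_nth
      by (simp add: sum_distrib_left mult.commute)
  next
    case False
    then show ?thesis
      using sum_mode_prob_edge[of j i] unfolding laplacian_nth by (simp add: sum_negf)
  qed
  then show ?thesis by (simp add: vec_eq_iff)
qed

lemma measurable_mode_process:
  "(\<lambda>\<xi>. mode_process E \<alpha> \<xi> j) \<in> measurable (measure_pmf \<mu> \<Otimes>\<^sub>M M) (count_space UNIV)"
proof (cases "j = 0")
  case True
  have "fst \<in> measurable (measure_pmf \<mu> \<Otimes>\<^sub>M M) (measure_pmf \<mu>)"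
    by simp
  then show ?thesis
    using True by (simp add: mode_process_def measurable_pmf_measure2 cong: measurable_cong_sets)
next
  case False
  then show ?thesis
    by (simp add: mode_process_def measurable_compose[OF measurable_snd measurable_modes])
qed

text \<open>Carries expectations in the stability and norm definitions from the product space over
  to \<open>path\<close> on \<open>M\<close>.\<close>

lemma integral_return_mode_process:
  fixes g :: "(nat \<Rightarrow> ('n \<times> 'n) set) \<Rightarrow> real"
  assumes "determined_below k g"
  shows "(\<integral>\<xi>. g (mode_process E \<alpha> \<xi>) \<partial>(measure_pmf (return_pmf m0) \<Otimes>\<^sub>M M))
    = (\<integral>\<omega>. g (path m0 \<omega>) \<partial>M)"
proof -
  interpret pair: pair_prob_space "measure_pmf (return_pmf m0)" M ..
  have "mode_process E \<alpha> (m0, \<omega>) = path m0 \<omega>" for \<omega>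
    by (simp add: fun_eq_iff mode_process_def path_def)
  then show ?thesis
    using integral_pair_return_pmf[OF prob_space_axioms
        integrable_determined_below[OF pair.P.finite_measure_axioms measurable_mode_process assms]]
    by simp
qed

end

theorem theorem10:
  fixes E :: "('n::finite \<times> 'n) set"
    and p \<gamma> :: real
    and M :: "'a measure"
    and \<alpha> :: "'n \<Rightarrow> 'n \<Rightarrow> nat \<Rightarrow> 'a \<Rightarrow> bool"
    and Sd Sc :: "('x::finite, 'w::finite, 'z::finite) lin_sys"
  assumes "irrefl E" and "sym E"
    and "0 \<le> p" and "p \<le> 1"
    and "bernoulli_packet_loss M E p \<alpha>"
    and "\<gamma> > 0"
  shows "(mean_square_stable M E \<alpha> Sd Sc \<longrightarrow> lti_stable (mean_system E p Sd Sc)) \<and>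
    (mean_square_stable M E \<alpha> Sd Sc \<and> jump_H2_norm M E \<alpha> Sd Sc < \<gamma> \<longrightarrow>
      lti_stable (mean_system E p Sd Sc) \<and> lti_H2_norm (mean_system E p Sd Sc) < \<gamma>)"
proof -
  interpret packet_loss M E p \<alpha>
    by (rule packet_loss.intro) fact
  define S where "S m = decomposable Sd Sc (laplacian m)" for m :: "('n \<times> 'n) set"
  interpret jump_lin_sys M "active_edges E \<alpha>" "mode_prob M E \<alpha>" S ..
  have mean: "mean_system E p Sd Sc = avg_sys"
    unfolding S_def mean_system_def avg_sys_decomposable sum_mode_prob_laplacian ..
  have jump: "jump_system E \<alpha> Sd Sc \<xi> = (\<lambda>j. S (mode_process E \<alpha> \<xi> j))" for \<xi>
    by (simp add: fun_eq_iff jump_system_def S_def)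

  have stable: "(\<lambda>k. \<integral>\<omega>. jstate x0 (\<lambda>_. 0) m0 k \<omega> \<bullet> jstate x0 (\<lambda>_. 0) m0 k \<omega> \<partial>M) \<longlonglongrightarrow> 0"
    if mss: "mean_square_stable M E \<alpha> Sd Sc" and "mode_prob M E \<alpha> m0 \<noteq> 0" for m0 x0
  proof -
    \<comment> \<open>A mode of nonzero probability consists of edges of \<open>E\<close>, so the
      point mass at it is an admissible initial distribution.\<close>
    have "set_pmf (return_pmf m0) \<subseteq> Pow E"
      using mode_prob_eq_0 that(2) by auto
    with mss have "(\<lambda>k. \<integral>\<xi>. state (jump_system E \<alpha> Sd Sc \<xi>) x0 (\<lambda>_. 0) k
        \<bullet> state (jump_system E \<alpha> Sd Sc \<xi>) x0 (\<lambda>_. 0) k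
          \<partial>(measure_pmf (return_pmf m0) \<Otimes>\<^sub>M M)) \<longlonglongrightarrow> 0"
      unfolding mean_square_stable_def Let_def norm_columnvector_rowvector by blast
    then show ?thesis
      unfolding jump
      by (subst (asm) integral_return_mode_process[OF determined_below_state[where f = "\<lambda>x. x \<bullet> x"]])
  qed

  have "lti_stable avg_sys" if "mean_square_stable M E \<alpha> Sd Sc"
    by (intro lti_stable_avg_sys avg_energy_tendsto_0 stable[OF that])
  moreover have "lti_H2_norm avg_sys \<le> jump_H2_norm M E \<alpha> Sd Sc"
    if mss: "mean_square_stable M E \<alpha> Sd Sc"
  proof -
    have out: "(\<integral>\<xi>. (let z = sys_output (jump_system E \<alpha> Sd Sc \<xi>) 0 (impulse s) k in z \<bullet> z)
        \<partial>(measure_pmf (return_pmf m0) \<Otimes>\<^sub>M M)) = output_energy m0 s k" for m0 s k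
      unfolding jump sys_output_def Let_def
      by (rule integral_return_mode_process[OF determined_below_state_mode[where f =
          "\<lambda>x m. (sysC (S m) *v x + sysD (S m) *v impulse s k)
                \<bullet> (sysC (S m) *v x + sysD (S m) *v impulse s k)"]])
    \<comment> \<open>The general results sum over all sets of vertex pairs, the norm only over
      subsets of \<open>E\<close>; the other sets have probability 0.\<close>
    have "(\<Sum>m\<in>UNIV. \<Sum>s\<in>UNIV. mode_prob M E \<alpha> m * (\<Sum>k. output_energy m s k))
        = (\<Sum>m\<in>Pow E. \<Sum>s\<in>UNIV. mode_prob M E \<alpha> m * (\<Sum>k. output_energy m s k))"
      by (intro sum.mono_neutral_right) (auto simp: mode_prob_eq_0)
    then show ?thesis
      using H2_le[OF energy_tendsto_0[OF stable[OF mss]]]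
      unfolding lti_H2_norm_def jump_H2_norm_def out by simp
  qed
  ultimately show ?thesis
    unfolding mean by fastforce
qed

end
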